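(* Let $\mathbb{F}$ be a field of characteristic not equal to $2$ with $|\mathbb{F}|\ge 4$, let $\mathcal{A}$ be a unital algebra over $\mathbb{F}$, and let $\mathcal{B}$ be an algebra containing $\mathcal{A}$ and sharing the same identity $I$ with $\mathcal{A}$, regarded as an $\mathcal{A}$-bimodule via the multiplication and addition of $\mathcal{B}$. Let $P\in\mathcal{A}$ be a non-trivial idempotent, $Q=I-P$, $E_1=P$, $E_2=Q$, $\mathcal{A}_{ij}=E_i\mathcal{A}E_j$, and assume that every element of $\mathcal{A}_{11}$ is a linear combination of invertible elements of $\mathcal{A}_{11}$ and every element of $\mathcal{A}_{22}$ is a linear combination of invertible elements of $\mathcal{A}_{22}$. Suppose $\mathcal{A}_{12}$ is faithful with respect to $\mathcal{B}$, $\mathcal{A}_{21}=\{0\}$, and $C(\mathcal{A},\mathcal{B})=\mathbb{F}I$. If $\delta\in L(\mathcal{A},\mathcal{B})$ is Jordan derivable at some $C\in\mathcal{A}$, then $\delta$ is a derivation. In particular, every $C\in\mathcal{A}$ is a Jordan all-derivable point of $L(\mathcal{A},\mathcal{B})$, and every Jordan derivation from $\mathcal{A}$ to $\mathcal{B}$ is a derivation.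
   Context: $L(\mathcal{A},\mathcal{B})$ is the set of all linear mappings from $\mathcal{A}$ to $\mathcal{B}$, and $C(\mathcal{A},\mathcal{B})=\{M\in\mathcal{B}: AM=MA\text{ for every }A\in\mathcal{A}\}$. A mapping $\delta\in L(\mathcal{A},\mathcal{B})$ is a derivation if $\delta(AB)=\delta(A)B+A\delta(B)$ for all $A,B\in\mathcal{A}$; it is a Jordan derivation if $\delta(AB+BA)=\delta(A)B+A\delta(B)+\delta(B)A+B\delta(A)$ for all $A,B\in\mathcal{A}$; it is Jordan derivable at $C\in\mathcal{A}$ if the latter identity holds for all $A,B\in\mathcal{A}$ with $AB=C$. An element $C\in\mathcal{A}$ is a Jordan all-derivable point of $L(\mathcal{A},\mathcal{B})$ if every $\delta\in L(\mathcal{A},\mathcal{B})$ that is Jordan derivable at $C$ is a Jordan derivation. Non-trivial idempotent means an idempotent different from $0$ and $I$. Invertible in $\mathcal{A}_{ii}$ means invertible with respect to the unit $E_i$, with inverse in $\mathcal{A}_{ii}$. $\mathcal{A}_{12}$ is faithful with respect to $\mathcal{B}$ if for every $M\in\mathcal{B}$: $M\mathcal{A}_{12}=\{0\}$ implies $MP=0$, and $\mathcal{A}_{12}M=\{0\}$ implies $QM=0$. *)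

theory Defs
  imports Complex_Main "HOL-Library.Cardinality"
begin

locale unital_algebra = vector_space scale
  for scale :: "'f::field \<Rightarrow> 'b::ring_1 \<Rightarrow> 'b" +
  assumes scale_mult_left: "scale c x * y = scale c (x * y)"
    and scale_mult_right: "x * scale c y = scale c (x * y)"

definition unital_subalgebra :: "('f::field \<Rightarrow> 'b::ring_1 \<Rightarrow> 'b) \<Rightarrow> 'b set \<Rightarrow> bool" where
  "unital_subalgebra scale \<A> \<longleftrightarrow>
     module.subspace scale \<A> \<and> 1 \<in> \<A> \<and> (\<forall>x\<in>\<A>. \<forall>y\<in>\<A>. x * y \<in> \<A>)"

text \<open>
  The linear mappings from the subspace \<open>\<A>\<close> to the whole algebra \<open>\<B>\<close>, which is the type \<open>'b\<close>.
  They are represented by functions on \<open>'b\<close> whose values outside \<open>\<A>\<close> are arbitrary; every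
  notion below only inspects values on \<open>\<A>\<close>.
\<close>

definition linear_maps :: "('f::field \<Rightarrow> 'b::ring_1 \<Rightarrow> 'b) \<Rightarrow> 'b set \<Rightarrow> ('b \<Rightarrow> 'b) set" where
  "linear_maps scale \<A> =
     {\<delta>. (\<forall>x\<in>\<A>. \<forall>y\<in>\<A>. \<delta> (x + y) = \<delta> x + \<delta> y) \<and>
         (\<forall>c. \<forall>x\<in>\<A>. \<delta> (scale c x) = scale c (\<delta> x))}"

definition derivation :: "('f::field \<Rightarrow> 'b::ring_1 \<Rightarrow> 'b) \<Rightarrow> 'b set \<Rightarrow> ('b \<Rightarrow> 'b) \<Rightarrow> bool" where
  "derivation scale \<A> \<delta> \<longleftrightarrow> \<delta> \<in> linear_maps scale \<A> \<and>
     (\<forall>A\<in>\<A>. \<forall>B\<in>\<A>. \<delta> (A * B) = \<delta> A * B + A * \<delta> B)"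

definition jordan_derivation :: "('f::field \<Rightarrow> 'b::ring_1 \<Rightarrow> 'b) \<Rightarrow> 'b set \<Rightarrow> ('b \<Rightarrow> 'b) \<Rightarrow> bool" where
  "jordan_derivation scale \<A> \<delta> \<longleftrightarrow> \<delta> \<in> linear_maps scale \<A> \<and>
     (\<forall>A\<in>\<A>. \<forall>B\<in>\<A>. \<delta> (A * B + B * A) = \<delta> A * B + A * \<delta> B + \<delta> B * A + B * \<delta> A)"

definition jordan_derivable_at ::
  "('f::field \<Rightarrow> 'b::ring_1 \<Rightarrow> 'b) \<Rightarrow> 'b set \<Rightarrow> ('b \<Rightarrow> 'b) \<Rightarrow> 'b \<Rightarrow> bool" where
  "jordan_derivable_at scale \<A> \<delta> C \<longleftrightarrow> \<delta> \<in> linear_maps scale \<A> \<and> C \<in> \<A> \<and>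
     (\<forall>A\<in>\<A>. \<forall>B\<in>\<A>. A * B = C \<longrightarrow>
        \<delta> (A * B + B * A) = \<delta> A * B + A * \<delta> B + \<delta> B * A + B * \<delta> A)"

definition jordan_all_derivable_point ::
  "('f::field \<Rightarrow> 'b::ring_1 \<Rightarrow> 'b) \<Rightarrow> 'b set \<Rightarrow> 'b \<Rightarrow> bool" where
  "jordan_all_derivable_point scale \<A> C \<longleftrightarrow> C \<in> \<A> \<and>
     (\<forall>\<delta>\<in>linear_maps scale \<A>. jordan_derivable_at scale \<A> \<delta> C \<longrightarrow> jordan_derivation scale \<A> \<delta>)"

definition commutant :: "'b::ring_1 set \<Rightarrow> 'b set" where
  "commutant \<A> = {M. \<forall>A\<in>\<A>. A * M = M * A}"

definition corner :: "'b::ring_1 set \<Rightarrow> 'b \<Rightarrow> 'b \<Rightarrow> 'b set" where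
  "corner \<A> E F = {E * x * F | x. x \<in> \<A>}"

text \<open>
  Invertibility in \<open>E \<A> E\<close> is relative to its own unit \<open>E\<close>, not to \<open>1\<close>.
\<close>

definition corner_units :: "'b::ring_1 set \<Rightarrow> 'b \<Rightarrow> 'b set" where
  "corner_units \<A> E =
     {x \<in> corner \<A> E E. \<exists>y \<in> corner \<A> E E. x * y = E \<and> y * x = E}"

definition faithful_corner :: "'b::ring_1 set \<Rightarrow> 'b \<Rightarrow> 'b \<Rightarrow> bool" where
  "faithful_corner \<A> P Q \<longleftrightarrow>
     (\<forall>M. ((\<lambda>T. M * T) ` corner \<A> P Q = {0} \<longrightarrow> M * P = 0) \<and>
          ((\<lambda>T. T * M) ` corner \<A> P Q = {0} \<longrightarrow> Q * M = 0))"

end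

theory Submission
  imports Defs
begin

text \<open>
  Let \<open>J(x, y)\<close> be the bilinear defect of the Jordan identity for \<open>\<delta>\<close>. Every \<open>C \<in> \<A>\<close> has a
  family of factorizations \<open>C = (a + u\<inverse> c) (b + u d)\<close> in which \<open>a\<close> and \<open>d\<close> do not depend on \<open>C\<close>;
  comparing coefficients of \<open>u\<close> gives \<open>J(a, d) = 0\<close>, that is
  \<open>J(\<A>\<^sub>1\<^sub>1, \<A>\<^sub>2\<^sub>2) = 0\<close>, \<open>J(a z, b) = J(a, z b)\<close> and \<open>J(\<A>\<^sub>1\<^sub>2, \<A>\<^sub>1\<^sub>2) = 0\<close>.
  Subtracting an inner derivation, which does not change \<open>J\<close>, makes \<open>\<delta> P\<close> and \<open>\<delta> Q\<close> block
  diagonal. Then \<open>\<delta>\<close> respects the Peirce decomposition, except for a part mapping \<open>\<A>\<^sub>1\<^sub>2\<close> into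
  \<open>Q \<B> P\<close>, which vanishes since the commutant is trivial; faithfulness yields
  \<open>\<delta> (x y) = \<delta> x y + x \<delta> y - c x y\<close> with a scalar \<open>c\<close>. Only \<open>c = 0\<close> needs \<open>C\<close> again:
  factor \<open>C = 1 C\<close> if \<open>C \<noteq> 0\<close>, and \<open>0 = z P\<close> with \<open>0 \<noteq> z \<in> \<A>\<^sub>1\<^sub>2\<close> otherwise.
\<close>

definition jordan_defect :: "('b::ring_1 \<Rightarrow> 'b) \<Rightarrow> 'b \<Rightarrow> 'b \<Rightarrow> 'b" where
  "jordan_defect \<delta> x y = \<delta> x * y + x * \<delta> y + \<delta> y * x + y * \<delta> x - \<delta> (x * y + y * x)"

text \<open>Inserting \<open>e\<close> and \<open>f\<close> between the two factors produces
  \<open>e * f\<close>. This is the source of every vanishing product of mismatched Peirce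
  components.\<close>

lemma mult_eq_zero_through:
  fixes x y e f :: "'b::ring_1"
  assumes "x * e = x" "f * y = y" "e * f = 0"
  shows "x * y = 0"
proof -
  have "x * y = (x * e) * (f * y)"
    using assms by simp
  also have "\<dots> = x * (e * f) * y"
    by (simp add: mult.assoc)
  finally show ?thesis
    using assms by simp
qed

text \<open>Images under \<open>\<delta>\<close> lie in the whole algebra, so corners of
  \<open>UNIV\<close> are needed besides those of \<open>\<A>\<close>.\<close>

lemma corner_UNIV_iff:
  fixes E F :: "'b::ring_1"
  assumes "E * E = E" "F * F = F"
  shows "x \<in> corner UNIV E F \<longleftrightarrow> E * x = x \<and> x * F = x"
proof
  assume "x \<in> corner UNIV E F"
  then show "E * x = x \<and> x * F = x"
    using assms by (auto simp: corner_def mult.assoc) (simp flip: mult.assoc)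
next
  assume "E * x = x \<and> x * F = x"
  then have "x = E * x * F" by simp
  then show "x \<in> corner UNIV E F"
    unfolding corner_def by blast
qed

section \<open>Peirce corners of a triangular subalgebra\<close>

locale char_not_2_algebra = unital_algebra scale
  for scale :: "'f::field \<Rightarrow> 'b::ring_1 \<Rightarrow> 'b" +
  assumes two_neq_zero: "(2::'f) \<noteq> 0"
begin

lemma double_eq_zero: "x + x = (0::'b) \<longleftrightarrow> x = 0"
proof -
  have "x + x = scale (1 + 1) x"
    by (simp only: scale_left_distrib scale_one)
  then show ?thesis
    using two_neq_zero by simp
qed

text \<open>Compressing by \<open>E\<close> on both sides gives twice \<open>E * x * E\<close>, so
  this element is zero. Multiplying by \<open>E\<close> on the right alone then leaves just
  \<open>x * E\<close>.\<close>

lemma anticommute_idempotent: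
  fixes E x :: 'b
  assumes E: "E * E = E" and x: "x * E + E * x = 0"
  shows "x * E = 0" "E * x = 0"
proof -
  have "E * (x * E + E * x) * E = E * x * E + E * x * E"
    using E by (simp add: algebra_simps) (simp add: E flip: mult.assoc)
  then have *: "E * x * E = 0"
    using x double_eq_zero by simp
  have "(x * E + E * x) * E = x * E + E * x * E"
    using E by (simp add: algebra_simps)
  with * x show "x * E = 0" by simp
  with x show "E * x = 0" by simp
qed

end

text \<open>The size of the field enters as a nonzero \<open>u\<close> different from its own
  inverse, the form in which coefficients of \<open>u\<close> and \<open>inverse u\<close> can be
  told apart.\<close>

locale triangular_subalgebra = char_not_2_algebra scale
  for scale :: "'f::field \<Rightarrow> 'b::ring_1 \<Rightarrow> 'b" +
  fixes \<A> :: "'b set" and P Q :: 'b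
  assumes field_big: "\<exists>u::'f. u \<noteq> 0 \<and> u * u \<noteq> 1"
    and subalgebra: "unital_subalgebra scale \<A>"
    and P_in: "P \<in> \<A>" and PP [simp]: "P * P = P" and P_neq_0: "P \<noteq> 0"
    and Q_def: "Q = 1 - P"
    and span_11: "\<And>x. x \<in> corner \<A> P P \<Longrightarrow> x \<in> span (corner_units \<A> P)"
    and span_22: "\<And>x. x \<in> corner \<A> Q Q \<Longrightarrow> x \<in> span (corner_units \<A> Q)"
    and faithful: "faithful_corner \<A> P Q"
    and corner_21: "corner \<A> Q P = {0}"
    and commutant: "commutant \<A> = range (\<lambda>c. scale c 1)"
begin

lemma subspace_A: "subspace \<A>"
  using subalgebra by (simp add: unital_subalgebra_def)

lemma in_A [simp, intro]:
  "0 \<in> \<A>" "1 \<in> \<A>" "P \<in> \<A>" "Q \<in> \<A>"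
  "x \<in> \<A> \<Longrightarrow> y \<in> \<A> \<Longrightarrow> x + y \<in> \<A>"
  "x \<in> \<A> \<Longrightarrow> y \<in> \<A> \<Longrightarrow> x - y \<in> \<A>"
  "x \<in> \<A> \<Longrightarrow> y \<in> \<A> \<Longrightarrow> x * y \<in> \<A>"
  "x \<in> \<A> \<Longrightarrow> - x \<in> \<A>"
  "x \<in> \<A> \<Longrightarrow> scale c x \<in> \<A>"
  using subspace_A subalgebra P_in
  by (auto simp: unital_subalgebra_def Q_def subspace_0 subspace_add subspace_diff
      subspace_neg subspace_scale)

lemma PQ_simps [simp]: "P * Q = 0" "Q * P = 0" "Q * Q = Q" "P + Q = 1"
  by (simp_all add: Q_def algebra_simps)

lemma PQ_assoc_simps [simp]:
  "P * (P * x) = P * x" "Q * (Q * x) = Q * x" "P * (Q * x) = 0" "Q * (P * x) = 0"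
  by (simp_all flip: mult.assoc)

lemma P_plus_Q_mult: "P * x + Q * x = x" "x * P + x * Q = x"
  by (simp_all flip: distrib_right distrib_left)

lemma peirce: "x = P * x * P + P * x * Q + Q * x * P + Q * x * Q"
  by (simp add: Q_def algebra_simps)

lemma corner_iff:
  assumes "E \<in> {P, Q}" "F \<in> {P, Q}"
  shows "x \<in> corner \<A> E F \<longleftrightarrow> x \<in> \<A> \<and> E * x = x \<and> x * F = x"
proof
  assume "x \<in> corner \<A> E F"
  then show "x \<in> \<A> \<and> E * x = x \<and> x * F = x"
    using assms by (auto simp: corner_def mult.assoc)
next
  assume "x \<in> \<A> \<and> E * x = x \<and> x * F = x"
  then have "x = E * x * F" "x \<in> \<A>" by simp_all
  then show "x \<in> corner \<A> E F"
    unfolding corner_def by blast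
qed

lemma corner_mult:
  "a \<in> corner \<A> P P \<Longrightarrow> a' \<in> corner \<A> P P \<Longrightarrow> a * a' \<in> corner \<A> P P"
  "a \<in> corner \<A> P P \<Longrightarrow> z \<in> corner \<A> P Q \<Longrightarrow> a * z \<in> corner \<A> P Q"
  "z \<in> corner \<A> P Q \<Longrightarrow> b \<in> corner \<A> Q Q \<Longrightarrow> z * b \<in> corner \<A> P Q"
  "b \<in> corner \<A> Q Q \<Longrightarrow> b' \<in> corner \<A> Q Q \<Longrightarrow> b * b' \<in> corner \<A> Q Q"
  by (auto simp: corner_iff mult.assoc) (simp_all flip: mult.assoc)

lemma corner_UNIV:
  assumes "E \<in> {P, Q}" "F \<in> {P, Q}"
  shows "x \<in> corner UNIV E F \<longleftrightarrow> E * x = x \<and> x * F = x"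
  using assms by (intro corner_UNIV_iff) auto

lemma mult_zero_PQ:
  "x * P = x \<Longrightarrow> Q * y = y \<Longrightarrow> x * y = 0"
  "x * Q = x \<Longrightarrow> P * y = y \<Longrightarrow> x * y = 0"
  by (auto intro: mult_eq_zero_through)

lemma QAP: "x \<in> \<A> \<Longrightarrow> Q * x * P = 0"
  using corner_21 unfolding corner_def by blast

lemma faithful_left:
  assumes "\<And>z. z \<in> corner \<A> P Q \<Longrightarrow> M * z = 0" "M * P = M"
  shows "M = 0"
proof -
  \<comment> \<open>Faithfulness speaks of an image equal to \<open>{0}\<close>, so the corner also
    has to be nonempty.\<close>
  have "0 \<in> corner \<A> P Q" by (simp add: corner_iff)
  then have "(\<lambda>T. M * T) ` corner \<A> P Q = {0}"
    using assms(1) by (auto simp: image_iff intro!: bexI[of _ 0])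
  then show ?thesis
    using faithful assms(2) unfolding faithful_corner_def by metis
qed

lemma faithful_right:
  assumes "\<And>z. z \<in> corner \<A> P Q \<Longrightarrow> z * M = 0" "Q * M = M"
  shows "M = 0"
proof -
  have "0 \<in> corner \<A> P Q" by (simp add: corner_iff)
  then have "(\<lambda>T. T * M) ` corner \<A> P Q = {0}"
    using assms(1) by (auto simp: image_iff intro!: bexI[of _ 0])
  then show ?thesis
    using faithful assms(2) unfolding faithful_corner_def by metis
qed

text \<open>If the corner were zero, \<open>P\<close> would annihilate it from the left, and
  faithfulness would force \<open>P = 0\<close>.\<close>

lemma obtain_corner_12: obtains z where "z \<in> corner \<A> P Q" "z \<noteq> 0"
proof -
  have "\<exists>z\<in>corner \<A> P Q. z \<noteq> 0"
    using faithful_left[of P] P_neq_0 corner_iff[of P Q] PP by auto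
  then show ?thesis using that by blast
qed

text \<open>Since \<open>Q * x * P = 0\<close> on \<open>\<A>\<close>, the three commutation rules
  are exactly what \<open>m + n\<close> needs to commute with all of \<open>\<A>\<close>. It is then
  a scalar, and compressing by \<open>P\<close> and by \<open>Q\<close> recovers \<open>m\<close>
  and \<open>n\<close>.\<close>

lemma central_element:
  assumes 11: "\<And>a. a \<in> corner \<A> P P \<Longrightarrow> a * m = m * a"
    and 22: "\<And>b. b \<in> corner \<A> Q Q \<Longrightarrow> b * n = n * b"
    and 12: "\<And>z. z \<in> corner \<A> P Q \<Longrightarrow> m * z = z * n"
    and m: "P * m = m" "m * P = m" and n: "Q * n = n" "n * Q = n"
  obtains c where "m = scale c P" "n = scale c Q"
proof -
  have "x * (m + n) = (m + n) * x" if x: "x \<in> \<A>" for x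
  proof -
    have c: "P * x * P \<in> corner \<A> P P" "P * x * Q \<in> corner \<A> P Q" "Q * x * Q \<in> corner \<A> Q Q"
      using x by (auto simp: corner_iff mult.assoc)
    have xe: "x = P * x * P + P * x * Q + Q * x * Q"
      using peirce[of x] QAP[OF x] by simp
    have z: "P * x * P * n = 0" "n * (P * x * P) = 0" "Q * x * Q * m = 0" "m * (Q * x * Q) = 0"
      "P * x * Q * m = 0" "n * (P * x * Q) = 0"
      using m n by (intro mult_zero_PQ; simp add: mult.assoc)+
    have "(P * x * P + P * x * Q + Q * x * Q) * (m + n)
        = (m + n) * (P * x * P + P * x * Q + Q * x * Q)"
      using 11[OF c(1)] 22[OF c(3)] 12[OF c(2)] z by (simp add: distrib_left distrib_right)
    then show ?thesis using xe by simp
  qed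
  then have "m + n \<in> commutant \<A>"
    by (simp add: commutant_def)
  then obtain c where c: "m + n = scale c 1"
    using commutant by auto
  have "P * n = 0" "Q * m = 0"
    using m n by (intro mult_zero_PQ; simp)+
  then have "m = P * scale c 1 * P" "n = Q * scale c 1 * Q"
    using m n by (simp_all add: distrib_left flip: c)
  then have "m = scale c P" "n = scale c Q"
    by (simp_all add: scale_mult_left scale_mult_right)
  then show ?thesis by (rule that)
qed

lemma linear_mapsD:
  assumes "\<delta> \<in> linear_maps scale \<A>"
  shows "x \<in> \<A> \<Longrightarrow> y \<in> \<A> \<Longrightarrow> \<delta> (x + y) = \<delta> x + \<delta> y"
    and "x \<in> \<A> \<Longrightarrow> \<delta> (scale c x) = scale c (\<delta> x)"
    and "\<delta> 0 = 0"
proof -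
  show "x \<in> \<A> \<Longrightarrow> y \<in> \<A> \<Longrightarrow> \<delta> (x + y) = \<delta> x + \<delta> y"
    and *: "x \<in> \<A> \<Longrightarrow> \<delta> (scale c x) = scale c (\<delta> x)" for x y c
    using assms by (auto simp: linear_maps_def)
  show "\<delta> 0 = 0"
    using *[of 0 0] by simp
qed

section \<open>The Jordan defect\<close>

lemma jordan_defect_commute: "jordan_defect \<delta> x y = jordan_defect \<delta> y x"
  by (simp add: jordan_defect_def algebra_simps)

lemma jordan_defect_add:
  assumes "\<delta> \<in> linear_maps scale \<A>" "x \<in> \<A>" "y \<in> \<A>" "z \<in> \<A>"
  shows "jordan_defect \<delta> (x + y) z = jordan_defect \<delta> x z + jordan_defect \<delta> y z"
    and "jordan_defect \<delta> z (x + y) = jordan_defect \<delta> z x + jordan_defect \<delta> z y"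
proof -
  have "\<delta> ((x + y) * z + z * (x + y)) = \<delta> (x * z + z * x) + \<delta> (y * z + z * y)"
    using assms by (subst linear_mapsD(1)[OF assms(1), symmetric]) (auto simp: algebra_simps)
  then show *: "jordan_defect \<delta> (x + y) z = jordan_defect \<delta> x z + jordan_defect \<delta> y z"
    using linear_mapsD(1)[OF assms(1-3)] unfolding jordan_defect_def by (simp add: algebra_simps)
  then show "jordan_defect \<delta> z (x + y) = jordan_defect \<delta> z x + jordan_defect \<delta> z y"
    by (simp add: jordan_defect_commute[of \<delta> z])
qed

lemma jordan_defect_scale:
  assumes "\<delta> \<in> linear_maps scale \<A>" "x \<in> \<A>" "z \<in> \<A>"
  shows "jordan_defect \<delta> (scale c x) z = scale c (jordan_defect \<delta> x z)"
    and "jordan_defect \<delta> z (scale c x) = scale c (jordan_defect \<delta> z x)"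
proof -
  have "\<delta> (scale c x * z + z * scale c x) = scale c (\<delta> (x * z + z * x))"
    using assms
    by (subst linear_mapsD(2)[OF assms(1), symmetric])
      (auto simp: scale_mult_left scale_mult_right scale_right_distrib)
  then show *: "jordan_defect \<delta> (scale c x) z = scale c (jordan_defect \<delta> x z)"
    using linear_mapsD(2)[OF assms(1,2)] unfolding jordan_defect_def
    by (simp add: scale_mult_left scale_mult_right scale_right_distrib scale_right_diff_distrib)
  then show "jordan_defect \<delta> z (scale c x) = scale c (jordan_defect \<delta> z x)"
    by (simp add: jordan_defect_commute[of \<delta> z])
qed

section \<open>Factorizations of \<open>C\<close> and the identities they force\<close>

lemma jordan_derivable_at_iff:
  "jordan_derivable_at scale \<A> \<delta> C \<longleftrightarrow> \<delta> \<in> linear_maps scale \<A> \<and> C \<in> \<A> \<and>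
     (\<forall>x\<in>\<A>. \<forall>y\<in>\<A>. x * y = C \<longrightarrow> jordan_defect \<delta> x y = 0)"
  by (auto simp: jordan_derivable_at_def jordan_defect_def)

text \<open>The values at \<open>u = 1\<close> and \<open>u = -1\<close> give \<open>r = 0\<close>
  and \<open>t = - s\<close>. One more \<open>u\<close> with \<open>u \<noteq> inverse u\<close>
  then leaves a nonzero multiple of \<open>s\<close>.\<close>

lemma laurent_coefficient:
  assumes "\<And>u. u \<noteq> 0 \<Longrightarrow> r + scale u s + scale (inverse u) t = 0"
  shows "s = 0"
proof -
  have 1: "r + s + t = 0" using assms[of 1] by simp
  have 2: "r - s - t = 0" using assms[of "-1"] by simp
  have "r + r = 0" using 1 2 by (metis add.assoc add.commute diff_add_cancel add_0)
  then have r: "r = 0" by (simp add: double_eq_zero)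
  with 1 have t: "t = - s" by (simp add: eq_neg_iff_add_eq_0 add.commute)
  obtain u :: 'f where u: "u \<noteq> 0" "u * u \<noteq> 1" using field_big by blast
  have "scale (u - inverse u) s = 0"
    using assms[OF u(1)] r t by (simp add: scale_left_diff_distrib)
  moreover have "u - inverse u \<noteq> 0"
    using u by (metis eq_iff_diff_eq_0 right_inverse)
  ultimately show ?thesis by simp
qed

text \<open>The cross terms \<open>a * d\<close> and \<open>c * b\<close> vanish, so the product of
  \<open>a + scale (inverse u) c\<close> and \<open>b + scale u d\<close> is \<open>C\<close> for
  every nonzero \<open>u\<close>. The defect of this pair is a Laurent polynomial in
  \<open>u\<close>, and the coefficient of \<open>u\<close> is the defect of \<open>a\<close> and
  \<open>d\<close>.\<close>

lemma jordan_defect_pencil: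
  assumes J: "jordan_derivable_at scale \<A> \<delta> C"
    and A: "a \<in> \<A>" "b \<in> \<A>" "c \<in> \<A>" "d \<in> \<A>"
    and eq: "a * b + c * d = C" "a * d = 0" "c * b = 0"
  shows "jordan_defect \<delta> a d = 0"
proof (rule laurent_coefficient)
  fix u :: 'f assume u: "u \<noteq> 0"
  have L: "\<delta> \<in> linear_maps scale \<A>"
    using J by (simp add: jordan_derivable_at_iff)
  have "(a + scale (inverse u) c) * (b + scale u d) = C"
    using eq u by (simp add: distrib_left distrib_right scale_mult_left scale_mult_right add.commute)
  then have "jordan_defect \<delta> (a + scale (inverse u) c) (b + scale u d) = 0"
    using J A by (auto simp: jordan_derivable_at_iff)
  then show "(jordan_defect \<delta> a b + jordan_defect \<delta> c d) + scale u (jordan_defect \<delta> a d)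
      + scale (inverse u) (jordan_defect \<delta> c b) = 0"
    using A u by (simp add: jordan_defect_add[OF L] jordan_defect_scale[OF L] scale_right_distrib
        add.commute add.left_commute)
qed

text \<open>
  The factorization \<open>C = (v + z + C\<^sub>2\<^sub>2 w') (v' C\<^sub>1\<^sub>1 + v' C\<^sub>1\<^sub>2 + w - v' z w)\<close>, where
  \<open>v'\<close> and \<open>w'\<close> invert \<open>v\<close> and \<open>w\<close> in their corners, has the free parameter \<open>z\<close> in \<open>\<A>\<^sub>1\<^sub>2\<close>.
\<close>

lemma jordan_defect_units:
  assumes J: "jordan_derivable_at scale \<A> \<delta> C"
    and v: "v \<in> corner \<A> P P" "v' \<in> corner \<A> P P" "v * v' = P"
    and w: "w \<in> corner \<A> Q Q" "w' \<in> corner \<A> Q Q" "w' * w = Q"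
    and z: "z \<in> corner \<A> P Q"
  shows "jordan_defect \<delta> (v + z) (w - v' * z * w) = 0"
proof (rule jordan_defect_pencil[OF J])
  have C: "C \<in> \<A>" using J by (simp add: jordan_derivable_at_iff)
  let ?b = "v' * C" and ?c = "Q * C * w'"
  have i: "v \<in> \<A>" "P * v = v" "v * P = v" "v' \<in> \<A>" "P * v' = v'" "v' * P = v'"
    "w \<in> \<A>" "Q * w = w" "w * Q = w" "w' \<in> \<A>" "Q * w' = w'" "w' * Q = w'"
    "z \<in> \<A>" "P * z = z" "z * Q = z"
    using v w z by (simp_all add: corner_iff)
  have 0: "v * w = 0" "z * v' = 0" "w' * v' = 0" "w' * z = 0"
    using i by (auto intro: mult_zero_PQ)
  show "v + z \<in> \<A>" "?b \<in> \<A>" "?c \<in> \<A>" "w - v' * z * w \<in> \<A>"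
    using i C by simp_all
  have vv: "v * (v' * x) = P * x" for x
    using v by (simp flip: mult.assoc)
  have zz: "z * (v' * x) = 0" "w' * (v' * x) = 0" for x
    by (simp_all add: 0 flip: mult.assoc)
  show "(v + z) * (w - v' * z * w) = 0"
    using 0 vv zz i by (simp add: distrib_left distrib_right right_diff_distrib mult.assoc)
      (simp add: i flip: mult.assoc)
  show "?c * ?b = 0"
    using zz by (simp add: mult.assoc)
  have "(v + z) * ?b + ?c * (w - v' * z * w) = P * C + Q * C * Q"
    using 0 vv zz w(3) by (simp add: distrib_left distrib_right right_diff_distrib mult.assoc)
  \<comment> \<open>Triangularity enters here: \<open>Q * C * P = 0\<close>.\<close>
  also have "Q * C * Q = Q * C"
    using P_plus_Q_mult(2)[of "Q * C"] QAP[OF C] by simp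
  finally show "(v + z) * ?b + ?c * (w - v' * z * w) = C"
    by (simp add: P_plus_Q_mult)
qed

text \<open>The zeros of \<open>F\<close> in \<open>\<A>\<close> form a subspace containing
  \<open>T\<close>. Linearity is asked for on \<open>\<A>\<close> only, because
  \<open>\<delta>\<close> is arbitrary outside it.\<close>

lemma span_vanish:
  assumes "x \<in> span T" "T \<subseteq> \<A>" "\<And>x. x \<in> T \<Longrightarrow> F x = (0::'b)"
    and "\<And>x y. x \<in> \<A> \<Longrightarrow> y \<in> \<A> \<Longrightarrow> F (x + y) = F x + F y"
    and "\<And>c x. x \<in> \<A> \<Longrightarrow> F (scale c x) = scale c (F x)"
  shows "F x = 0"
proof -
  have "F 0 = 0" using assms(5)[of 0 0] by simp
  then have "subspace {x \<in> \<A>. F x = 0}"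
    using assms(4,5) by (auto simp: subspace_def)
  then have "span T \<subseteq> {x \<in> \<A>. F x = 0}"
    using assms(2,3) by (intro span_minimal) auto
  with assms(1) show ?thesis by auto
qed

lemma corner_units_subset: "E \<in> {P, Q} \<Longrightarrow> corner_units \<A> E \<subseteq> \<A>"
  by (auto simp: corner_units_def corner_iff)

lemma vanish_11:
  assumes "a \<in> corner \<A> P P" "\<And>v. v \<in> corner_units \<A> P \<Longrightarrow> F v = (0::'b)"
    and "\<And>x y. x \<in> \<A> \<Longrightarrow> y \<in> \<A> \<Longrightarrow> F (x + y) = F x + F y"
    and "\<And>c x. x \<in> \<A> \<Longrightarrow> F (scale c x) = scale c (F x)"
  shows "F a = 0"
  using span_vanish[OF span_11[OF assms(1)] corner_units_subset assms(2-4)] by simp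

lemma vanish_22:
  assumes "b \<in> corner \<A> Q Q" "\<And>v. v \<in> corner_units \<A> Q \<Longrightarrow> F v = (0::'b)"
    and "\<And>x y. x \<in> \<A> \<Longrightarrow> y \<in> \<A> \<Longrightarrow> F (x + y) = F x + F y"
    and "\<And>c x. x \<in> \<A> \<Longrightarrow> F (scale c x) = scale c (F x)"
  shows "F b = 0"
  using span_vanish[OF span_22[OF assms(1)] corner_units_subset assms(2-4)] by simp

text \<open>The free parameter of \<open>jordan_defect_units\<close> is set to \<open>0\<close>,
  \<open>v * z\<close> and \<open>- (v * z)\<close>. The terms linear in \<open>z\<close> change
  sign and the quadratic one does not, so adding the last two relations isolates the quadratic
  term.\<close>

lemma jordan_defect_units_split:
  assumes J: "jordan_derivable_at scale \<A> \<delta> C"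
    and v: "v \<in> corner_units \<A> P" and w: "w \<in> corner_units \<A> Q"
  shows "jordan_defect \<delta> v w = 0"
    and "z \<in> corner \<A> P Q \<Longrightarrow> jordan_defect \<delta> (v * z) w = jordan_defect \<delta> v (z * w)"
    and "z \<in> corner \<A> P Q \<Longrightarrow> jordan_defect \<delta> (v * z) (z * w) = 0"
proof -
  have L: "\<delta> \<in> linear_maps scale \<A>"
    using J by (simp add: jordan_derivable_at_iff)
  obtain v' w' where v': "v \<in> corner \<A> P P" "v' \<in> corner \<A> P P" "v * v' = P" "v' * v = P"
    and w': "w \<in> corner \<A> Q Q" "w' \<in> corner \<A> Q Q" "w' * w = Q"
    using v w by (auto simp: corner_units_def)
  note units = jordan_defect_units[OF J v'(1-3) w']
  have i: "v \<in> \<A>" "w \<in> \<A>"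
    using v' w' by (simp_all add: corner_iff)
  show vw: "jordan_defect \<delta> v w = 0"
    using units[of 0] by (simp add: corner_iff)
  assume z: "z \<in> corner \<A> P Q"
  then have zi: "z \<in> \<A>" "P * z = z" "z * Q = z" by (simp_all add: corner_iff)
  have vz: "v * z \<in> corner \<A> P Q" by (rule corner_mult(2)[OF v'(1) z])
  have mvz: "- (v * z) \<in> corner \<A> P Q"
    using vz by (simp add: corner_iff)
  have v'v: "v' * (v * x) = P * x" for x using v'(4) by (simp flip: mult.assoc)
  have Pz: "P * (z * w) = z * w" using zi by (simp flip: mult.assoc)
  have neg: "jordan_defect \<delta> (- x) y = - jordan_defect \<delta> x y"
    if "x \<in> \<A>" "y \<in> \<A>" for x y
    using jordan_defect_scale(1)[OF L that, of "-1"] by simp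
  have neg': "jordan_defect \<delta> y (- x) = - jordan_defect \<delta> y x"
    if "x \<in> \<A>" "y \<in> \<A>" for x y
    using jordan_defect_scale(2)[OF L that, of "-1"] by simp
  have "jordan_defect \<delta> (v + v * z) (w + - (z * w)) = 0"
    using units[OF vz] by (simp add: mult.assoc v'v Pz)
  then have p: "jordan_defect \<delta> (v * z) w - jordan_defect \<delta> v (z * w) - jordan_defect \<delta> (v * z) (z * w) = 0"
    using i zi vw by (simp add: jordan_defect_add[OF L] neg' del: add_uminus_conv_diff)
      (simp add: algebra_simps)
  have "jordan_defect \<delta> (v + - (v * z)) (w + z * w) = 0"
    using units[OF mvz] by (simp add: mult.assoc v'v Pz)
  then have m: "jordan_defect \<delta> v (z * w) - jordan_defect \<delta> (v * z) w - jordan_defect \<delta> (v * z) (z * w) = 0"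
    using i zi vw by (simp add: jordan_defect_add[OF L] neg del: add_uminus_conv_diff)
      (simp add: algebra_simps)
  have "- (jordan_defect \<delta> (v * z) (z * w) + jordan_defect \<delta> (v * z) (z * w))
      = (jordan_defect \<delta> (v * z) w - jordan_defect \<delta> v (z * w) - jordan_defect \<delta> (v * z) (z * w))
        + (jordan_defect \<delta> v (z * w) - jordan_defect \<delta> (v * z) w - jordan_defect \<delta> (v * z) (z * w))"
    by (simp add: algebra_simps)
  then have "jordan_defect \<delta> (v * z) (z * w) + jordan_defect \<delta> (v * z) (z * w) = 0"
    unfolding p m by (simp only: add_0_right neg_equal_0_iff_equal)
  then show vzzw: "jordan_defect \<delta> (v * z) (z * w) = 0"
    by (simp add: double_eq_zero)
  show "jordan_defect \<delta> (v * z) w = jordan_defect \<delta> v (z * w)"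
    using p vzzw by simp
qed

text \<open>Invertible elements span both corners, so the identity for units extends by bilinearity,
  one variable at a time.\<close>

lemma jordan_defect_11_22:
  assumes J: "jordan_derivable_at scale \<A> \<delta> C"
    and a: "a \<in> corner \<A> P P" and b: "b \<in> corner \<A> Q Q"
  shows "jordan_defect \<delta> a b = 0"
proof -
  have L: "\<delta> \<in> linear_maps scale \<A>"
    using J by (simp add: jordan_derivable_at_iff)
  have "jordan_defect \<delta> v b = 0" if "v \<in> corner_units \<A> P" for v
    by (rule vanish_22[OF b])
      (use that corner_units_subset[of P] jordan_defect_units_split(1)[OF J that] in
        \<open>auto simp: jordan_defect_add[OF L] jordan_defect_scale[OF L]\<close>)
  then show ?thesis
    by (rule vanish_11[OF a])
      (use b in \<open>auto simp: jordan_defect_add[OF L] jordan_defect_scale[OF L] corner_iff\<close>)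
qed

lemma jordan_defect_balanced:
  assumes J: "jordan_derivable_at scale \<A> \<delta> C"
    and a: "a \<in> corner \<A> P P" and z: "z \<in> corner \<A> P Q" and b: "b \<in> corner \<A> Q Q"
  shows "jordan_defect \<delta> (a * z) b = jordan_defect \<delta> a (z * b)"
proof -
  have L: "\<delta> \<in> linear_maps scale \<A>"
    using J by (simp add: jordan_derivable_at_iff)
  have i: "z \<in> \<A>" "b \<in> \<A>" using z b by (simp_all add: corner_iff)
  note simps = jordan_defect_add[OF L] jordan_defect_scale[OF L] distrib_left distrib_right
    scale_mult_left scale_mult_right scale_right_diff_distrib
  have "jordan_defect \<delta> (v * z) b - jordan_defect \<delta> v (z * b) = 0" if v: "v \<in> corner_units \<A> P" for v
  proof -
    have "v \<in> \<A>" using v corner_units_subset[of P] by auto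
    then show ?thesis
      by (intro vanish_22[OF b, where F = "\<lambda>b. jordan_defect \<delta> (v * z) b - jordan_defect \<delta> v (z * b)"])
        (use i jordan_defect_units_split(2)[OF J v _ z] in \<open>auto simp: simps\<close>)
  qed
  then have "jordan_defect \<delta> (a * z) b - jordan_defect \<delta> a (z * b) = 0"
    by (intro vanish_11[OF a, where F = "\<lambda>a. jordan_defect \<delta> (a * z) b - jordan_defect \<delta> a (z * b)"])
      (use i in \<open>auto simp: simps\<close>)
  then show ?thesis by simp
qed

text \<open>Taking the units \<open>P\<close> and \<open>Q\<close> shows that the defect of
  \<open>x\<close> with itself vanishes on the corner; the general case follows by
  polarization.\<close>

lemma jordan_defect_12_12:
  assumes J: "jordan_derivable_at scale \<A> \<delta> C"
    and z: "z \<in> corner \<A> P Q" and w: "w \<in> corner \<A> P Q"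
  shows "jordan_defect \<delta> z w = 0"
proof -
  have L: "\<delta> \<in> linear_maps scale \<A>"
    using J by (simp add: jordan_derivable_at_iff)
  have "P \<in> corner_units \<A> P" "Q \<in> corner_units \<A> Q"
    by (auto simp: corner_units_def corner_iff intro!: bexI[of _ P] bexI[of _ Q])
  then have sq: "jordan_defect \<delta> x x = 0" if "x \<in> corner \<A> P Q" for x
    using jordan_defect_units_split(3)[OF J _ _ that] that by (force simp: corner_iff)
  have "z + w \<in> corner \<A> P Q"
    using z w by (simp add: corner_iff distrib_left distrib_right)
  then have "jordan_defect \<delta> z w + jordan_defect \<delta> z w = 0"
    using sq[of "z + w"] sq[OF z] sq[OF w] z w jordan_defect_commute[of \<delta> w z]
    by (simp add: jordan_defect_add[OF L] corner_iff)
  then show ?thesis by (simp add: double_eq_zero)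
qed

lemma linear_maps_diff_inner:
  assumes L: "\<delta> \<in> linear_maps scale \<A>"
  shows "(\<lambda>x. \<delta> x - (x * m - m * x)) \<in> linear_maps scale \<A>"
  using linear_mapsD[OF L]
  by (auto simp: linear_maps_def algebra_simps scale_mult_left scale_mult_right scale_right_diff_distrib
      scale_right_distrib)

text \<open>The subtracted map is an inner derivation, which has zero defect.\<close>

lemma jordan_defect_diff_inner:
  "jordan_defect (\<lambda>x. \<delta> x - (x * m - m * x)) x y = jordan_defect \<delta> x y"
  by (simp add: jordan_defect_def algebra_simps)

end


section \<open>Block diagonal images of the idempotents\<close>

text \<open>The assumptions collect the consequences of derivability at \<open>C\<close> without
  mentioning \<open>C\<close>, so the structural argument is uniform in \<open>C\<close>.\<close>

locale normalized_map = triangular_subalgebra scale \<A> P Q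
  for scale :: "'f::field \<Rightarrow> 'b::ring_1 \<Rightarrow> 'b" and \<A> P Q +
  fixes \<delta> :: "'b \<Rightarrow> 'b"
  assumes linear: "\<delta> \<in> linear_maps scale \<A>"
    and defect_11_22: "\<And>a b. a \<in> corner \<A> P P \<Longrightarrow> b \<in> corner \<A> Q Q \<Longrightarrow> jordan_defect \<delta> a b = 0"
    and defect_balanced: "\<And>a z b. a \<in> corner \<A> P P \<Longrightarrow> z \<in> corner \<A> P Q \<Longrightarrow> b \<in> corner \<A> Q Q \<Longrightarrow>
      jordan_defect \<delta> (a * z) b = jordan_defect \<delta> a (z * b)"
    and defect_12_12: "\<And>z w. z \<in> corner \<A> P Q \<Longrightarrow> w \<in> corner \<A> P Q \<Longrightarrow> jordan_defect \<delta> z w = 0"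
    and delta_P: "\<delta> P \<in> corner UNIV P P"
    and delta_Q: "\<delta> Q \<in> corner UNIV Q Q"
begin

lemmas lin = linear_mapsD[OF linear]

lemma P_corner: "P \<in> corner \<A> P P" and Q_corner: "Q \<in> corner \<A> Q Q"
  by (simp_all add: corner_iff)

lemma delta_P_simps [simp]: "P * \<delta> P = \<delta> P" "\<delta> P * P = \<delta> P" "Q * \<delta> P = 0" "\<delta> P * Q = 0"
  using delta_P by (auto simp: corner_UNIV intro: mult_zero_PQ)

lemma delta_Q_simps [simp]: "Q * \<delta> Q = \<delta> Q" "\<delta> Q * Q = \<delta> Q" "P * \<delta> Q = 0" "\<delta> Q * P = 0"
  using delta_Q by (auto simp: corner_UNIV intro: mult_zero_PQ)

text \<open>As \<open>\<delta> Q\<close> lies in the opposite corner, the vanishing defect of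
  \<open>a\<close> and \<open>Q\<close> reduces to
  \<open>\<delta> a * Q + Q * \<delta> a = 0\<close>.\<close>

lemma delta_11:
  assumes "a \<in> corner \<A> P P"
  shows "P * \<delta> a = \<delta> a" "\<delta> a * P = \<delta> a"
proof -
  have a: "P * a = a" "a * P = a" "a * Q = 0" "Q * a = 0" "a * \<delta> Q = 0" "\<delta> Q * a = 0"
    using assms by (auto simp: corner_iff intro: mult_zero_PQ)
  have "\<delta> a * Q + Q * \<delta> a = 0"
    using defect_11_22[OF assms Q_corner] a by (simp add: jordan_defect_def lin(3))
  then have "\<delta> a * Q = 0" "Q * \<delta> a = 0"
    by (intro anticommute_idempotent; simp)+
  then show "P * \<delta> a = \<delta> a" "\<delta> a * P = \<delta> a"
    using P_plus_Q_mult[of "\<delta> a"] by simp_all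
qed

lemma delta_22:
  assumes "b \<in> corner \<A> Q Q"
  shows "Q * \<delta> b = \<delta> b" "\<delta> b * Q = \<delta> b"
proof -
  have b: "Q * b = b" "b * Q = b" "b * P = 0" "P * b = 0" "b * \<delta> P = 0" "\<delta> P * b = 0"
    using assms by (auto simp: corner_iff intro: mult_zero_PQ)
  have "\<delta> b * P + P * \<delta> b = 0"
    using defect_11_22[OF P_corner assms] b by (simp add: jordan_defect_def lin(3) add.commute)
  then have "\<delta> b * P = 0" "P * \<delta> b = 0"
    by (intro anticommute_idempotent; simp)+
  then show "Q * \<delta> b = \<delta> b" "\<delta> b * Q = \<delta> b"
    using P_plus_Q_mult[of "\<delta> b"] by simp_all
qed

text \<open>The balanced identity with \<open>a = P\<close> and \<open>b = Q\<close> is read off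
  corner by corner. Its \<open>Q\<close>-\<open>P\<close> corner is trivially true, so nothing is
  learned yet about \<open>Q * \<delta> z * P\<close>.\<close>

lemma delta_12:
  assumes "z \<in> corner \<A> P Q"
  shows "P * \<delta> z * P = 0" "Q * \<delta> z * Q = 0" "\<delta> P * z = z * \<delta> Q"
proof -
  have z: "P * z = z" "z * Q = z" "z * P = 0" "Q * z = 0" "z * \<delta> P = 0" "\<delta> Q * z = 0"
    using assms by (auto simp: corner_iff intro: mult_zero_PQ)
  have e: "\<delta> z * Q + z * \<delta> Q + Q * \<delta> z = \<delta> P * z + P * \<delta> z + \<delta> z * P"
    using defect_balanced[OF P_corner assms Q_corner] z by (simp add: jordan_defect_def)
  have z': "z * (P * y) = 0" "Q * (z * y) = 0" "Q * (\<delta> P * y) = 0" for y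
    using z by (simp_all flip: mult.assoc)
  have "P * (\<delta> z * Q + z * \<delta> Q + Q * \<delta> z) * P = P * (\<delta> P * z + P * \<delta> z + \<delta> z * P) * P"
    using e by simp
  then have "P * \<delta> z * P + P * \<delta> z * P = 0"
    using z z' by (simp add: distrib_left distrib_right mult.assoc)
  then show "P * \<delta> z * P = 0" by (simp add: double_eq_zero)
  have "Q * (\<delta> z * Q + z * \<delta> Q + Q * \<delta> z) * Q = Q * (\<delta> P * z + P * \<delta> z + \<delta> z * P) * Q"
    using e by simp
  then have "Q * \<delta> z * Q + Q * \<delta> z * Q = 0"
    using z z' by (simp add: distrib_left distrib_right mult.assoc)
  then show "Q * \<delta> z * Q = 0" by (simp add: double_eq_zero)
  have "P * (\<delta> z * Q + z * \<delta> Q + Q * \<delta> z) * Q = P * (\<delta> P * z + P * \<delta> z + \<delta> z * P) * Q"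
    using e by simp
  moreover have "P * (z * \<delta> Q) = z * \<delta> Q" "P * (\<delta> P * z) = \<delta> P * z"
    using z by (simp_all flip: mult.assoc)
  ultimately show "\<delta> P * z = z * \<delta> Q"
    using z by (simp add: distrib_left distrib_right mult.assoc)
qed

section \<open>The component of the map from \<open>P \<A> Q\<close> into the opposite
  corner\<close>

definition comp12 :: "'b \<Rightarrow> 'b" where "comp12 z = P * \<delta> z * Q"
text \<open>The unwanted component, eventually shown to vanish on
  \<open>corner \<A> P Q\<close>.\<close>

definition comp21 :: "'b \<Rightarrow> 'b" where "comp21 z = Q * \<delta> z * P"

lemma comp_corner:
  "P * comp12 z = comp12 z" "comp12 z * Q = comp12 z"
  "Q * comp21 z = comp21 z" "comp21 z * P = comp21 z"
  by (simp_all add: comp21_def comp12_def mult.assoc)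

lemma delta_12_split: "z \<in> corner \<A> P Q \<Longrightarrow> \<delta> z = comp12 z + comp21 z"
  using peirce[of "\<delta> z"] delta_12 by (simp add: comp21_def comp12_def)

text \<open>In the balanced identity the terms \<open>\<delta> (a * z * b)\<close> cancel and the
  reversed products are zero. What remains splits into its \<open>Q\<close>-\<open>P\<close> and
  \<open>P\<close>-\<open>Q\<close> corners.\<close>

lemma delta_bimodule:
  assumes A: "a \<in> corner \<A> P P" and Z: "z \<in> corner \<A> P Q" and B: "b \<in> corner \<A> Q Q"
  shows "b * comp21 (a * z) = comp21 (z * b) * a"
    and "comp12 (a * z) * b + a * z * \<delta> b = \<delta> a * z * b + a * comp12 (z * b)"
proof -
  have c: "P * a = a" "a * P = a" "P * z = z" "z * Q = z" "Q * b = b" "b * Q = b"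
    "P * \<delta> a = \<delta> a" "\<delta> a * P = \<delta> a" "Q * \<delta> b = \<delta> b" "\<delta> b * Q = \<delta> b"
    using A Z B delta_11 delta_22 by (auto simp: corner_iff)
  have 0: "b * z = 0" "z * a = 0" "\<delta> b * a = 0" "b * \<delta> a = 0" "b * a = 0"
    "comp12 x * a = 0" "b * comp12 x = 0" "a * comp21 x = 0" "comp21 x * b = 0" for x
    using c comp_corner by (auto intro: mult_zero_PQ)
  have e0: "comp12 (a * z) * b + a * z * \<delta> b + b * comp21 (a * z)
      = \<delta> a * z * b + a * comp12 (z * b) + comp21 (z * b) * a"
    using defect_balanced[OF A Z B] 0 delta_12_split[OF corner_mult(2)[OF A Z]]
      delta_12_split[OF corner_mult(3)[OF Z B]]
    by (simp add: jordan_defect_def distrib_left distrib_right mult.assoc)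
      (simp add: 0 flip: mult.assoc)
  have k: "Q * comp12 x = 0" "Q * a = 0" "Q * \<delta> a = 0" "comp21 x * Q = 0" "a * Q = 0" "P * b = 0" "P * comp21 x = 0" for x
    using c comp_corner by (auto intro: mult_zero_PQ)
  have "Q * (comp12 (a * z) * b + a * z * \<delta> b + b * comp21 (a * z))
      = Q * (\<delta> a * z * b + a * comp12 (z * b) + comp21 (z * b) * a)"
    using e0 by simp
  then show "b * comp21 (a * z) = comp21 (z * b) * a"
    using c k comp_corner by (simp add: distrib_left flip: mult.assoc)
  then show "comp12 (a * z) * b + a * z * \<delta> b = \<delta> a * z * b + a * comp12 (z * b)"
    using e0 by simp
qed

text \<open>Both products of \<open>z\<close> and \<open>w\<close> are zero, and so are those
  involving \<open>comp12\<close>. The vanishing defect is therefore a sum of one element of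
  \<open>P B P\<close> and one of \<open>Q B Q\<close>, where \<open>B\<close> is the whole
  algebra.\<close>

lemma comp21_anti:
  assumes Z: "z \<in> corner \<A> P Q" and W: "w \<in> corner \<A> P Q"
  shows "z * comp21 w + w * comp21 z = 0" "comp21 z * w + comp21 w * z = 0"
proof -
  have c: "P * z = z" "z * Q = z" "P * w = w" "w * Q = w"
    using Z W by (auto simp: corner_iff)
  have 0: "z * w = 0" "w * z = 0" "z * comp12 x = 0" "w * comp12 x = 0" "comp12 x * z = 0" "comp12 x * w = 0" for x
    using c comp_corner by (auto intro: mult_zero_PQ)
  have e: "comp21 z * w + z * comp21 w + comp21 w * z + w * comp21 z = 0"
    using defect_12_12[OF Z W] 0 delta_12_split[OF Z] delta_12_split[OF W]
    by (simp add: jordan_defect_def distrib_left distrib_right lin(3))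
  have k: "P * comp21 x = 0" "Q * z = 0" "Q * w = 0" for x
    using c comp_corner by (auto intro: mult_zero_PQ)
  have "P * (comp21 z * w + z * comp21 w + comp21 w * z + w * comp21 z) = 0"
    using e by simp
  then show "z * comp21 w + w * comp21 z = 0"
    using c k by (simp add: distrib_left flip: mult.assoc)
  then show "comp21 z * w + comp21 w * z = 0"
    using e by (simp add: algebra_simps) (metis add.assoc add.commute add.right_neutral)
qed

text \<open>
  The element \<open>z * comp21 w - comp21 w * z\<close> commutes with \<open>\<A>\<close>, hence is a scalar \<open>c\<close>;
  then \<open>c z = z * comp21 w * z = - c z\<close>.
\<close>

lemma comp21_eq_0:
  assumes W: "w \<in> corner \<A> P Q"
  shows "comp21 w = 0"
proof (rule faithful_right)
  show "Q * comp21 w = comp21 w" by (rule comp_corner)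
  fix z assume Z: "z \<in> corner \<A> P Q"
  \<comment> \<open>\<open>comp21\<close> swaps the sides of the module actions: the left action of
    \<open>P \<A> P\<close> becomes a right action, and conversely for
    \<open>Q \<A> Q\<close>.\<close>
  have fl: "comp21 (a * x) = comp21 x * a" if "a \<in> corner \<A> P P" "x \<in> corner \<A> P Q" for a x
    using delta_bimodule(1)[OF that Q_corner] that by (simp add: comp_corner corner_iff)
  have fr: "comp21 (x * b) = b * comp21 x" if "x \<in> corner \<A> P Q" "b \<in> corner \<A> Q Q" for b x
    using delta_bimodule(1)[OF P_corner that] that by (simp add: comp_corner corner_iff)
  have anti: "x * comp21 y = - (y * comp21 x)" "comp21 x * y = - (comp21 y * x)"
    if "x \<in> corner \<A> P Q" "y \<in> corner \<A> P Q" for x y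
    using comp21_anti[OF that] by (simp_all add: eq_neg_iff_add_eq_0)
  have z: "P * z = z" "z * Q = z"
    using Z by (simp_all add: corner_iff)
  have zc: "x * (z * comp21 w) = (z * comp21 w) * x" if "x \<in> corner \<A> P P" for x
    using anti(1)[OF corner_mult(2)[OF that Z] W] anti(1)[OF Z W] fl[OF that Z]
    by (simp add: mult.assoc)
  have wc: "x * (- (comp21 w * z)) = (- (comp21 w * z)) * x" if "x \<in> corner \<A> Q Q" for x
  proof -
    have "comp21 w * z * x = - (comp21 (z * x) * w)"
      using anti(2)[OF W corner_mult(3)[OF Z that]] by (simp add: mult.assoc)
    also have "\<dots> = x * (comp21 w * z)"
      using anti(2)[OF W Z] fr[OF Z that] by (simp add: mult.assoc)
    finally show ?thesis by simp
  qed
  \<comment> \<open>Three exchanges, each costing a sign: \<open>w\<close> with \<open>x\<close>,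
    then \<open>z\<close> with \<open>x\<close>, then \<open>z\<close> with
    \<open>w\<close>.\<close>
  have cr: "(z * comp21 w) * x = x * (- (comp21 w * z))" if "x \<in> corner \<A> P Q" for x
  proof -
    have "(z * comp21 w) * x = z * (comp21 w * x)" by (simp add: mult.assoc)
    also have "\<dots> = - (z * comp21 x * w)" using anti(2)[OF W that] by (simp add: mult.assoc)
    also have "\<dots> = x * (comp21 z * w)" using anti(1)[OF Z that] by (simp add: mult.assoc)
    also have "\<dots> = x * (- (comp21 w * z))" using anti(2)[OF Z W] by simp
    finally show ?thesis .
  qed
  obtain c where c: "z * comp21 w = scale c P" "- (comp21 w * z) = scale c Q"
  proof (rule central_element[of "z * comp21 w" "- (comp21 w * z)"])
    show "P * (z * comp21 w) = z * comp21 w" "z * comp21 w * P = z * comp21 w"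
      "Q * (- (comp21 w * z)) = - (comp21 w * z)" "- (comp21 w * z) * Q = - (comp21 w * z)"
      using z comp_corner by (simp_all add: mult.assoc) (simp_all add: comp_corner z flip: mult.assoc)
  qed (use zc wc cr in auto)
  have "scale c z = (z * comp21 w) * z"
    using c z by (simp add: scale_mult_left)
  also have "\<dots> = z * (comp21 w * z)"
    by (simp add: mult.assoc)
  also have "\<dots> = - scale c z"
    using c(2) z by (metis minus_minus mult_minus_right scale_mult_right)
  finally have "scale c z + scale c z = 0"
    by (simp add: eq_neg_iff_add_eq_0)
  \<comment> \<open>Either \<open>c = 0\<close> or \<open>z = 0\<close>, and the product vanishes in
    both cases.\<close>
  then show "z * comp21 w = 0"
    using c by (auto simp: double_eq_zero)
qed

section \<open>Product rules between Peirce components\<close>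

lemma delta_12_corner:
  assumes "z \<in> corner \<A> P Q"
  shows "P * \<delta> z = \<delta> z" "\<delta> z * Q = \<delta> z"
  using delta_12_split[OF assms] comp21_eq_0[OF assms] comp_corner by simp_all

lemma delta_bimodule':
  assumes "a \<in> corner \<A> P P" "z \<in> corner \<A> P Q" "b \<in> corner \<A> Q Q"
  shows "\<delta> (a * z) * b + a * z * \<delta> b = \<delta> a * z * b + a * \<delta> (z * b)"
  using delta_bimodule(2)[OF assms] delta_12_split[of "a * z"] delta_12_split[of "z * b"]
    comp21_eq_0[of "a * z"] comp21_eq_0[of "z * b"] corner_mult assms by simp

text \<open>This is the case \<open>b = Q\<close> of the bimodule identity, with
  \<open>z * \<delta> Q\<close> rewritten as \<open>\<delta> P * z\<close>. The last term is the
  deviation from the Leibniz rule.\<close>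

lemma delta_left:
  assumes "a \<in> corner \<A> P P" "z \<in> corner \<A> P Q"
  shows "\<delta> (a * z) = \<delta> a * z + a * \<delta> z - a * \<delta> P * z"
proof -
  have "\<delta> (a * z) * Q + a * z * \<delta> Q = \<delta> a * z * Q + a * \<delta> (z * Q)"
    using delta_bimodule'[OF assms Q_corner] .
  moreover have "\<delta> (a * z) * Q = \<delta> (a * z)" "z * Q = z" 
    using delta_12_corner[OF corner_mult(2)[OF assms]] assms by (simp_all add: corner_iff)
  ultimately show ?thesis
    using delta_12(3)[OF assms(2)] by (simp add: mult.assoc algebra_simps)
qed

lemma delta_right:
  assumes "z \<in> corner \<A> P Q" "b \<in> corner \<A> Q Q"
  shows "\<delta> (z * b) = \<delta> z * b + z * \<delta> b - z * \<delta> Q * b"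
proof -
  have "\<delta> (P * z) * b + P * z * \<delta> b = \<delta> P * z * b + P * \<delta> (z * b)"
    using delta_bimodule'[OF P_corner assms] .
  moreover have "P * \<delta> (z * b) = \<delta> (z * b)" "P * z = z" 
    using delta_12_corner[OF corner_mult(3)[OF assms]] assms by (simp_all add: corner_iff)
  ultimately show ?thesis
    using delta_12(3)[OF assms(1)] by (simp add: algebra_simps)
qed

text \<open>\<open>\<delta> (a * a' * z)\<close> is computed with both bracketings. The comparison
  holds for all \<open>z\<close> in the corner, and faithfulness cancels \<open>z\<close>.\<close>

lemma delta_11_mult:
  assumes A: "a \<in> corner \<A> P P" and A': "a' \<in> corner \<A> P P"
  shows "\<delta> (a * a') = \<delta> a * a' + a * \<delta> a' - a * a' * \<delta> P"
proof -
  have "\<delta> (a * a') - (\<delta> a * a' + a * \<delta> a' - a * a' * \<delta> P) = 0"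
  proof (rule faithful_left)
    fix z assume Z: "z \<in> corner \<A> P Q"
    have "\<delta> (a * a') * z + a * a' * \<delta> z - a * a' * \<delta> P * z = \<delta> (a * a' * z)"
      using delta_left[OF corner_mult(1)[OF A A'] Z] by simp
    also have "\<dots> = \<delta> (a * (a' * z))" by (simp add: mult.assoc)
    also have "\<dots> = \<delta> a * (a' * z) + a * (\<delta> a' * z + a' * \<delta> z - a' * \<delta> P * z) - a * \<delta> P * (a' * z)"
      using delta_left[OF A corner_mult(2)[OF A' Z]] delta_left[OF A' Z] by simp
    \<comment> \<open>\<open>\<delta> P\<close> passes \<open>a'\<close> by way of
      \<open>\<delta> Q\<close>: both sides equal \<open>a * a' * z * \<delta> Q\<close>.\<close>
    also have "a * \<delta> P * (a' * z) = a * a' * \<delta> P * z"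
      using delta_12(3)[OF Z] delta_12(3)[OF corner_mult(2)[OF A' Z]] by (simp add: mult.assoc)
    finally show "(\<delta> (a * a') - (\<delta> a * a' + a * \<delta> a' - a * a' * \<delta> P)) * z = 0"
      by (simp add: algebra_simps)
  next
    show "(\<delta> (a * a') - (\<delta> a * a' + a * \<delta> a' - a * a' * \<delta> P)) * P
      = \<delta> (a * a') - (\<delta> a * a' + a * \<delta> a' - a * a' * \<delta> P)"
      using delta_11[OF A'] delta_11[OF corner_mult(1)[OF A A']] A'
      by (simp add: algebra_simps corner_iff)
  qed
  then show ?thesis by simp
qed

lemma delta_22_mult:
  assumes B: "b \<in> corner \<A> Q Q" and B': "b' \<in> corner \<A> Q Q"
  shows "\<delta> (b * b') = \<delta> b * b' + b * \<delta> b' - \<delta> Q * b * b'"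
proof -
  have "\<delta> (b * b') - (\<delta> b * b' + b * \<delta> b' - \<delta> Q * b * b') = 0"
  proof (rule faithful_right)
    fix z assume Z: "z \<in> corner \<A> P Q"
    have "\<delta> z * (b * b') + z * \<delta> (b * b') - z * \<delta> Q * (b * b') = \<delta> (z * (b * b'))"
      using delta_right[OF Z corner_mult(4)[OF B B']] by simp
    also have "\<dots> = \<delta> (z * b * b')" by (simp add: mult.assoc)
    also have "\<dots> = (\<delta> z * b + z * \<delta> b - z * \<delta> Q * b) * b' + z * b * \<delta> b' - z * b * \<delta> Q * b'"
      using delta_right[OF corner_mult(3)[OF Z B] B'] delta_right[OF Z B] by simp
    also have "z * b * \<delta> Q * b' = z * \<delta> Q * b * b'"
      using delta_12(3)[OF Z] delta_12(3)[OF corner_mult(3)[OF Z B]] by (metis mult.assoc)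
    finally show "z * (\<delta> (b * b') - (\<delta> b * b' + b * \<delta> b' - \<delta> Q * b * b')) = 0"
      by (simp add: algebra_simps)
  next
    show "Q * (\<delta> (b * b') - (\<delta> b * b' + b * \<delta> b' - \<delta> Q * b * b'))
      = \<delta> (b * b') - (\<delta> b * b' + b * \<delta> b' - \<delta> Q * b * b')"
      using delta_22[OF B] delta_22[OF corner_mult(4)[OF B B']] B
      by (simp add: algebra_simps corner_iff) (simp flip: mult.assoc)
  qed
  then show ?thesis by simp
qed

text \<open>The product rule for \<open>P * a\<close> has the correction
  \<open>a * \<delta> P\<close>, so comparison with \<open>\<delta> a\<close> gives commutation with
  \<open>\<delta> P\<close>; likewise for \<open>b * Q\<close> and
  \<open>\<delta> Q\<close>.\<close>

lemma delta_PQ_scalar: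
  obtains c where "\<delta> P = scale c P" "\<delta> Q = scale c Q"
proof (rule central_element[of "\<delta> P" "\<delta> Q"])
  show "a * \<delta> P = \<delta> P * a" if "a \<in> corner \<A> P P" for a
    using delta_11_mult[OF P_corner that] delta_11[OF that] that by (simp add: corner_iff)
  show "b * \<delta> Q = \<delta> Q * b" if "b \<in> corner \<A> Q Q" for b
    using delta_22_mult[OF that Q_corner] delta_22[OF that] that
    by (simp add: corner_iff mult.assoc)
qed (use delta_12(3) that in auto)

lemma almost_derivation:
  obtains c where "\<delta> P = scale c P" "\<delta> Q = scale c Q"
    and "\<And>x y. x \<in> \<A> \<Longrightarrow> y \<in> \<A> \<Longrightarrow> \<delta> (x * y) = \<delta> x * y + x * \<delta> y - scale c (x * y)"
proof -
  obtain c where c: "\<delta> P = scale c P" "\<delta> Q = scale c Q"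
    by (rule delta_PQ_scalar)
  have "\<delta> (x * y) = \<delta> x * y + x * \<delta> y - scale c (x * y)" if "x \<in> \<A>" "y \<in> \<A>" for x y
  proof -
    define x1 x2 x3 where "x1 = P * x * P" and "x2 = P * x * Q" and "x3 = Q * x * Q"
    define y1 y2 y3 where "y1 = P * y * P" and "y2 = P * y * Q" and "y3 = Q * y * Q"
    have x: "x = x1 + x2 + x3" and y: "y = y1 + y2 + y3"
      using peirce[of x] peirce[of y] QAP that
      by (simp_all add: x1_def x2_def x3_def y1_def y2_def y3_def)
    have mem: "x1 \<in> corner \<A> P P" "x2 \<in> corner \<A> P Q" "x3 \<in> corner \<A> Q Q"
      "y1 \<in> corner \<A> P P" "y2 \<in> corner \<A> P Q" "y3 \<in> corner \<A> Q Q"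
      using that
      by (auto simp: corner_iff mult.assoc x1_def x2_def x3_def y1_def y2_def y3_def)
    note k = mem[unfolded corner_iff[of P P, simplified] corner_iff[of P Q, simplified]
        corner_iff[of Q Q, simplified]]
    note d = delta_11[OF mem(1)] delta_12_corner[OF mem(2)] delta_22[OF mem(3)]
      delta_11[OF mem(4)] delta_12_corner[OF mem(5)] delta_22[OF mem(6)]
    \<comment> \<open>Only four of the nine products of components survive. The same holds after
      applying \<open>\<delta>\<close> to either factor, since \<open>\<delta>\<close> now preserves
      each corner.\<close>
    have z: "x1 * y3 = 0" "x2 * y1 = 0" "x2 * y2 = 0" "x3 * y1 = 0" "x3 * y2 = 0"
      "\<delta> x1 * y3 = 0" "\<delta> x2 * y1 = 0" "\<delta> x2 * y2 = 0" "\<delta> x3 * y1 = 0" "\<delta> x3 * y2 = 0"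
      "x1 * \<delta> y3 = 0" "x2 * \<delta> y1 = 0" "x2 * \<delta> y2 = 0" "x3 * \<delta> y1 = 0" "x3 * \<delta> y2 = 0"
      using k d by (auto intro: mult_zero_PQ)
    have m: "\<delta> (x1 * y1) = \<delta> x1 * y1 + x1 * \<delta> y1 - scale c (x1 * y1)"
      "\<delta> (x1 * y2) = \<delta> x1 * y2 + x1 * \<delta> y2 - scale c (x1 * y2)"
      "\<delta> (x2 * y3) = \<delta> x2 * y3 + x2 * \<delta> y3 - scale c (x2 * y3)"
      "\<delta> (x3 * y3) = \<delta> x3 * y3 + x3 * \<delta> y3 - scale c (x3 * y3)"
      using delta_11_mult[OF mem(1,4)] delta_left[OF mem(1,5)] delta_right[OF mem(2,6)]
        delta_22_mult[OF mem(3,6)] k c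
      by (simp_all add: scale_mult_left scale_mult_right mult.assoc)
    have dx: "\<delta> x = \<delta> x1 + \<delta> x2 + \<delta> x3" and dy: "\<delta> y = \<delta> y1 + \<delta> y2 + \<delta> y3"
      unfolding x y using k by (simp_all add: lin(1))
    have xy: "x * y = x1 * y1 + x1 * y2 + x2 * y3 + x3 * y3"
      unfolding x y using z by (simp add: distrib_left distrib_right)
    have "\<delta> x * y = \<delta> x1 * y1 + \<delta> x1 * y2 + \<delta> x2 * y3 + \<delta> x3 * y3"
      unfolding dx y using z by (simp add: distrib_left distrib_right)
    moreover have "x * \<delta> y = x1 * \<delta> y1 + x1 * \<delta> y2 + x2 * \<delta> y3 + x3 * \<delta> y3"
      unfolding dy x using z by (simp add: distrib_left distrib_right)
    moreover have "\<delta> (x * y) = \<delta> (x1 * y1) + \<delta> (x1 * y2) + \<delta> (x2 * y3) + \<delta> (x3 * y3)"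
      unfolding xy using k by (simp add: lin(1))
    ultimately show ?thesis
      unfolding m by (simp add: xy scale_right_distrib)
  qed
  with c that show ?thesis by blast
qed

end


section \<open>Jordan derivable maps are derivations\<close>

context triangular_subalgebra
begin

lemma derivation_if_derivable:
  assumes J: "jordan_derivable_at scale \<A> \<delta> C"
  shows "derivation scale \<A> \<delta>"
proof -
  have L: "\<delta> \<in> linear_maps scale \<A>" and C: "C \<in> \<A>"
    using J by (simp_all add: jordan_derivable_at_iff)
  \<comment> \<open>The commutator \<open>P * m - m * P\<close> is the off-diagonal part of
    \<open>\<delta> P\<close>.\<close>
  define m where "m = P * \<delta> P * Q - Q * \<delta> P * P"
  define \<delta>' where "\<delta>' = (\<lambda>x. \<delta> x - (x * m - m * x))"
  have J': "jordan_derivable_at scale \<A> \<delta>' C"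
    using J linear_maps_diff_inner[OF L, of m]
    by (simp add: jordan_derivable_at_iff \<delta>'_def jordan_defect_diff_inner)
  have PQ: "P \<in> corner \<A> P P" "Q \<in> corner \<A> Q Q"
    by (simp_all add: corner_iff)
  have e: "\<delta> P * Q + P * \<delta> Q + \<delta> Q * P + Q * \<delta> P = 0"
    using jordan_defect_11_22[OF J PQ] linear_mapsD(3)[OF L] by (simp add: jordan_defect_def)
  have e': "X * (\<delta> P * Q + P * \<delta> Q + \<delta> Q * P + Q * \<delta> P) * Y = 0" for X Y
    using e by simp
  have e_PP: "P * \<delta> Q * P = 0"
    using e'[of P P] by (simp add: distrib_left distrib_right mult.assoc double_eq_zero)
  have e_QQ: "Q * \<delta> P * Q = 0"
    using e'[of Q Q] by (simp add: distrib_left distrib_right mult.assoc double_eq_zero)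
  \<comment> \<open>The off-diagonal parts of \<open>\<delta> P\<close> and
    \<open>\<delta> Q\<close> are opposite, so the same \<open>m\<close> normalizes both.\<close>
  have e_PQ: "P * \<delta> P * Q + P * \<delta> Q * Q = 0"
    using e'[of P Q] by (simp add: distrib_left distrib_right mult.assoc)
  have e_QP: "Q * \<delta> P * P + Q * \<delta> Q * P = 0"
    using e'[of Q P] by (simp add: distrib_left distrib_right mult.assoc add.commute)
  have "\<delta>' P = \<delta> P - (P * \<delta> P * Q + Q * \<delta> P * P)"
    by (simp add: \<delta>'_def m_def algebra_simps)
  also have "\<dots> = P * \<delta> P * P"
    using peirce[of "\<delta> P"] e_QQ by (simp add: algebra_simps)
  finally have P': "\<delta>' P \<in> corner UNIV P P"
    by (simp add: corner_UNIV mult.assoc)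
  have "\<delta>' Q = \<delta> Q + (P * \<delta> P * Q + Q * \<delta> P * P)"
    by (simp add: \<delta>'_def m_def algebra_simps)
  also have "\<dots> = \<delta> Q - (P * \<delta> Q * Q + Q * \<delta> Q * P)"
    using e_PQ e_QP by (simp add: eq_neg_iff_add_eq_0[symmetric])
  also have "\<dots> = Q * \<delta> Q * Q"
    using peirce[of "\<delta> Q"] e_PP by (simp add: algebra_simps)
  finally have Q': "\<delta>' Q \<in> corner UNIV Q Q"
    by (simp add: corner_UNIV mult.assoc)
  interpret n: normalized_map scale \<A> P Q \<delta>'
  proof
    show "\<delta>' \<in> linear_maps scale \<A>"
      using J' by (simp add: jordan_derivable_at_iff)
  qed (use jordan_defect_11_22[OF J'] jordan_defect_balanced[OF J'] jordan_defect_12_12[OF J'] P' Q' in auto)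
  obtain c where c: "\<delta>' P = scale c P" "\<delta>' Q = scale c Q"
    and d: "\<And>x y. x \<in> \<A> \<Longrightarrow> y \<in> \<A> \<Longrightarrow> \<delta>' (x * y) = \<delta>' x * y + x * \<delta>' y - scale c (x * y)"
    using n.almost_derivation by blast
  \<comment> \<open>By \<open>d\<close>, the defect of \<open>x\<close> and \<open>y\<close> is
    \<open>scale c (x * y + y * x)\<close>. The chosen factorizations make this
    \<open>scale c z\<close> or twice \<open>scale c C\<close>.\<close>
  have "c = 0"
  proof (cases "C = 0")
    case True
    obtain z where z: "z \<in> corner \<A> P Q" "z \<noteq> 0" by (rule obtain_corner_12)
    then have i: "z \<in> \<A>" "P * z = z" "z * P = 0"
      by (auto simp: corner_iff intro: mult_zero_PQ)
    have "jordan_defect \<delta>' z P = 0"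
      using J' True i by (simp add: jordan_derivable_at_iff)
    moreover have "\<delta>' z * P = 0"
      using n.delta_12_corner[OF z(1)] by (auto intro: mult_zero_PQ)
    ultimately have "scale c z = 0"
      using i n.delta_12_corner[OF z(1)]
      by (simp add: jordan_defect_def c scale_mult_left scale_mult_right)
    then show ?thesis using z by simp
  next
    case False
    have one: "\<delta>' 1 = scale c 1"
      using n.lin(1)[of P Q] c by (simp flip: scale_right_distrib)
    have "jordan_defect \<delta>' 1 C = 0"
      using J' C by (simp add: jordan_derivable_at_iff)
    then have "scale c C + scale c C = 0"
      using n.lin(1)[OF C C]
      by (simp add: jordan_defect_def one scale_mult_left scale_mult_right)
    then show ?thesis using False by (simp add: double_eq_zero)
  qed
  then have "\<delta> (x * y) = \<delta> x * y + x * \<delta> y" if "x \<in> \<A>" "y \<in> \<A>" for x y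
    using d[OF that] by (simp add: \<delta>'_def algebra_simps)
  then show ?thesis
    using L by (simp add: derivation_def)
qed

end

section \<open>Arithmetic of the ground field and conclusion\<close>

lemma exists_square_neq_1:
  assumes "infinite (UNIV :: 'f::field set) \<or> CARD('f) \<ge> 4"
  shows "\<exists>u::'f. u \<noteq> 0 \<and> u * u \<noteq> 1"
proof (rule ccontr)
  assume "\<not> ?thesis"
  \<comment> \<open>In a field, \<open>1\<close> and \<open>-1\<close> are the only square roots of
    \<open>1\<close>.\<close>
  then have "(UNIV :: 'f set) \<subseteq> {0, 1, -1}"
    by (auto simp: square_eq_1_iff)
  then have "finite (UNIV :: 'f set)" "CARD('f) \<le> card {0, 1, -1 :: 'f}"
    by (rule finite_subset, simp) (rule card_mono, simp, fact)
  moreover have "card {0, 1, -1 :: 'f} \<le> 3"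
    using card_length[of "[0, 1, -1 :: 'f]"] by simp
  ultimately show False
    using assms by linarith
qed

text \<open>If \<open>2 = 0\<close>, the characteristic divides \<open>2\<close>, and it cannot be
  \<open>1\<close> in a field.\<close>

lemma two_neq_zero_if_CHAR:
  assumes "CHAR('f::field) \<noteq> 2"
  shows "(2::'f) \<noteq> 0"
proof
  assume "(2::'f) = 0"
  then have "CHAR('f) dvd 2"
    using of_nat_eq_0_iff_char_dvd[of 2, where 'a = 'f] by simp
  then have "CHAR('f) \<noteq> 0" "CHAR('f) \<le> 2"
    by (metis dvd_0_left zero_neq_numeral) (simp add: dvd_imp_le \<open>CHAR('f) dvd 2\<close>)
  then have "CHAR('f) = 1 \<or> CHAR('f) = 2"
    by linarith
  then show False
    using assms CHAR_not_1[where 'a = 'f] by simp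
qed

theorem corollary2p6:
  fixes scale :: "'f::field \<Rightarrow> 'b::ring_1 \<Rightarrow> 'b"
    and \<A> :: "'b set" and P Q :: 'b
  assumes "CHAR('f) \<noteq> 2"
    and "infinite (UNIV :: 'f set) \<or> CARD('f) \<ge> 4"
    and "unital_algebra scale"
    and "unital_subalgebra scale \<A>"
    and "P \<in> \<A>" and "P * P = P" and "P \<noteq> 0" and "P \<noteq> 1"
    and "Q = 1 - P"
    and "\<forall>x \<in> corner \<A> P P. x \<in> module.span scale (corner_units \<A> P)"
    and "\<forall>x \<in> corner \<A> Q Q. x \<in> module.span scale (corner_units \<A> Q)"
    and "faithful_corner \<A> P Q"
    and "corner \<A> Q P = {0}"
    and "commutant \<A> = range (\<lambda>c. scale c 1)"
  shows "(\<forall>\<delta> \<in> linear_maps scale \<A>.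
            (\<exists>C \<in> \<A>. jordan_derivable_at scale \<A> \<delta> C) \<longrightarrow> derivation scale \<A> \<delta>) \<and>
         (\<forall>C \<in> \<A>. jordan_all_derivable_point scale \<A> C) \<and>
         (\<forall>\<delta>. jordan_derivation scale \<A> \<delta> \<longrightarrow> derivation scale \<A> \<delta>)"
proof -
  interpret unital_algebra scale by fact
  interpret triangular_subalgebra scale \<A> P Q
    using assms two_neq_zero_if_CHAR exists_square_neq_1 by unfold_locales auto
  have "jordan_derivation scale \<A> \<delta>" if "derivation scale \<A> \<delta>" for \<delta>
    using that linear_mapsD(1)[of \<delta>]
    by (auto simp: derivation_def jordan_derivation_def algebra_simps)
  \<comment> \<open>A Jordan derivation is derivable at any point of \<open>\<A>\<close>;
    \<open>0\<close> serves as the witness.\<close>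
  moreover have "jordan_derivable_at scale \<A> \<delta> 0" if "jordan_derivation scale \<A> \<delta>" for \<delta>
    using that in_A(1) unfolding jordan_derivation_def jordan_derivable_at_def by blast
  ultimately show ?thesis
    using derivation_if_derivable unfolding jordan_all_derivable_point_def by blast
qed

end
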